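(* Let $\varepsilon>0$. Clients arrive one at a time (with all incident edges) into a bipartite graph with fixed server set $S$, every client having at least one neighbor. For the current graph $G$, let $\alpha(s)$ be the (unique) balanced server flow value of server $s$ and $L(s)=\lceil(1+\varepsilon)\alpha(s)\rceil$. A $(1+\varepsilon)$-approximate semi-matching is an assignment of every client to a neighboring server in which each server $s$ is assigned at most $L(s)$ clients. If the algorithm maintains a $(1+\varepsilon)$-approximate semi-matching using the SAP rule (upon arrival of a client, augment along a shortest augmenting path from it to a server $s$ having fewer than $L(s)$ assigned clients), then each client insertion causes, in the worst case, $O(\frac{1}{\varepsilon}\log n)$ reassignments, where $n$ is the number of clients that have arrived so far.
   Context: For a bipartite graph $G=(C\cup S,E)$ with every client having at least one neighbor, a server flow is a map $\alpha:S\to\mathbb R_{\ge0}$ for which there exist nonnegative reals $(x_e)_{e\in E}$ with $\sum_{s\in N(c)}x_{cs}=1$ for every $c\in C$ and $\sum_{c\in N(s)}x_{cs}=\alpha(s)$ for every $s\in S$. It is balanced if such $x$ can be chosen with $x_{cs}=0$ whenever $s\notin A(c):=\arg\min_{s'\in N(c)}\alpha(s')$. The values of a balanced server flow exist and are unique. An augmenting path alternates between non-assignment and assignment edges, starting at the new client and ending at a server with spare allowance; augmenting flips its edges.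
   Formalization: The constant hidden in O((1/ε) log n) is uniform for all ε in (0, ε₀] and may depend on the arbitrary upper bound ε₀, since no single constant works for all ε>0: as ε→∞ one reassignment can be forced while (1/ε) log n tends to 0. *)

theory Defs
  imports "HOL-Analysis.Analysis"
begin

definition client_server_graph :: "'c set \<Rightarrow> 's set \<Rightarrow> ('c \<times> 's) set \<Rightarrow> bool" where
  "client_server_graph C S E \<longleftrightarrow>
     finite C \<and> finite S \<and> E \<subseteq> C \<times> S \<and> (\<forall>c\<in>C. E `` {c} \<noteq> {})"

definition carries ::
  "'c set \<Rightarrow> 's set \<Rightarrow> ('c \<times> 's) set \<Rightarrow> ('c \<times> 's \<Rightarrow> real) \<Rightarrow> ('s \<Rightarrow> real) \<Rightarrow> bool" where
  "carries C S E x \<alpha> \<longleftrightarrow>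
     (\<forall>e\<in>E. 0 \<le> x e) \<and>
     (\<forall>c\<in>C. (\<Sum>s\<in>E `` {c}. x (c, s)) = 1) \<and>
     (\<forall>s\<in>S. (\<Sum>c\<in>E\<inverse> `` {s}. x (c, s)) = \<alpha> s)"

definition server_flow :: "'c set \<Rightarrow> 's set \<Rightarrow> ('c \<times> 's) set \<Rightarrow> ('s \<Rightarrow> real) \<Rightarrow> bool" where
  "server_flow C S E \<alpha> \<longleftrightarrow> \<alpha> \<in> S \<rightarrow>\<^sub>E {0..} \<and> (\<exists>x. carries C S E x \<alpha>)"

definition active_servers :: "('c \<times> 's) set \<Rightarrow> ('s \<Rightarrow> real) \<Rightarrow> 'c \<Rightarrow> 's set" where
  "active_servers E \<alpha> c = {s. is_arg_min \<alpha> (\<lambda>s'. s' \<in> E `` {c}) s}"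

definition balanced_server_flow ::
  "'c set \<Rightarrow> 's set \<Rightarrow> ('c \<times> 's) set \<Rightarrow> ('s \<Rightarrow> real) \<Rightarrow> bool" where
  "balanced_server_flow C S E \<alpha> \<longleftrightarrow>
     server_flow C S E \<alpha> \<and>
     (\<exists>x. carries C S E x \<alpha> \<and>
          (\<forall>(c, s)\<in>E. s \<notin> active_servers E \<alpha> c \<longrightarrow> x (c, s) = 0))"

definition balanced_value :: "'c set \<Rightarrow> 's set \<Rightarrow> ('c \<times> 's) set \<Rightarrow> 's \<Rightarrow> real" where
  "balanced_value C S E = (THE \<alpha>. balanced_server_flow C S E \<alpha>)"

text \<open>
  Existence: a server flow minimising the sum of squares is balanced, since moving flow of a client
  to a neighbour of smaller value would decrease the sum. Uniqueness: two balanced server flows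
  \<open>\<alpha>\<close>, \<open>\<beta>\<close> satisfy \<open>\<Sum> \<alpha>\<^sup>2 \<le> \<Sum> \<alpha> \<beta>\<close> and \<open>\<Sum> \<beta>\<^sup>2 \<le> \<Sum> \<alpha> \<beta>\<close>.
\<close>

lemma sum_edges_by_client:
  assumes "client_server_graph C S E"
  shows "(\<Sum>s\<in>S. \<Sum>c\<in>E\<inverse> `` {s}. f c s) = (\<Sum>c\<in>C. \<Sum>s\<in>E `` {c}. (f c s :: real))"
proof -
  have fin: "finite C" "finite S" "E \<subseteq> C \<times> S" using assms by (auto simp: client_server_graph_def)
  have 1: "(\<Sum>c\<in>E\<inverse> `` {s}. f c s) = (\<Sum>c\<in>C. if (c,s) \<in> E then f c s else 0)" if "s \<in> S" for s
    using fin by (subst sum.inter_filter[symmetric]) (auto intro!: sum.cong)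
  have 2: "(\<Sum>s\<in>E `` {c}. f c s) = (\<Sum>s\<in>S. if (c,s) \<in> E then f c s else 0)" if "c \<in> C" for c
    using fin by (subst sum.inter_filter[symmetric]) (auto intro!: sum.cong)
  have "(\<Sum>s\<in>S. \<Sum>c\<in>E\<inverse> `` {s}. f c s) = (\<Sum>s\<in>S. \<Sum>c\<in>C. if (c,s) \<in> E then f c s else 0)"
    using 1 by simp
  also have "\<dots> = (\<Sum>c\<in>C. \<Sum>s\<in>S. if (c,s) \<in> E then f c s else 0)"
    by (rule sum.swap)
  finally show ?thesis using 2 by simp
qed

lemma balanced_sum_le:
  assumes G: "client_server_graph C S E"
    and a: "balanced_server_flow C S E \<alpha>" and b: "server_flow C S E \<beta>"
  shows "(\<Sum>s\<in>S. \<alpha> s * \<alpha> s) \<le> (\<Sum>s\<in>S. \<alpha> s * \<beta> s)"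
proof -
  obtain x where x: "carries C S E x \<alpha>"
      "\<forall>(c, s)\<in>E. s \<notin> active_servers E \<alpha> c \<longrightarrow> x (c, s) = 0"
    using a by (auto simp: balanced_server_flow_def)
  obtain y where y: "carries C S E y \<beta>"
    using b by (auto simp: server_flow_def)
  have exp: "(\<Sum>s\<in>S. \<alpha> s * \<gamma> s) = (\<Sum>c\<in>C. \<Sum>s\<in>E `` {c}. \<alpha> s * z (c, s))"
    if "carries C S E z \<gamma>" for z \<gamma>
  proof -
    have "(\<Sum>s\<in>S. \<alpha> s * \<gamma> s) = (\<Sum>s\<in>S. \<Sum>c\<in>E\<inverse> `` {s}. \<alpha> s * z (c, s))"
      using that by (intro sum.cong) (auto simp: carries_def sum_distrib_left[symmetric])
    then show ?thesis by (simp add: sum_edges_by_client[OF G])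
  qed
  have "(\<Sum>s\<in>E `` {c}. \<alpha> s * x (c, s)) \<le> (\<Sum>s\<in>E `` {c}. \<alpha> s * y (c, s))" if "c \<in> C" for c
  proof -
    have ne: "finite (\<alpha> ` E `` {c})" "\<alpha> ` E `` {c} \<noteq> {}"
      using G that by (auto simp: client_server_graph_def intro: finite_subset)
    define m where "m = Min (\<alpha> ` E `` {c})"
    have m: "m \<le> \<alpha> s" if "s \<in> E `` {c}" for s
      using ne that by (auto simp: m_def)
    have "m \<in> \<alpha> ` E `` {c}" unfolding m_def using ne by (rule Min_in)
    then obtain s0 where s0: "s0 \<in> E `` {c}" "\<alpha> s0 = m" by auto
    have "\<alpha> s * x (c, s) = m * x (c, s)" if s: "s \<in> E `` {c}" for s
    proof (cases "s \<in> active_servers E \<alpha> c")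
      case True
      then have "\<alpha> s \<le> m" using s0 by (auto simp: active_servers_def is_arg_min_def not_less)
      then show ?thesis using m[OF s] by simp
    next
      case False
      then show ?thesis using x(2) s by auto
    qed
    then have "(\<Sum>s\<in>E `` {c}. \<alpha> s * x (c, s)) = m * (\<Sum>s\<in>E `` {c}. x (c, s))"
      unfolding sum_distrib_left by (rule sum.cong[OF refl])
    also have "\<dots> = m * (\<Sum>s\<in>E `` {c}. y (c, s))"
      using x(1) y that by (simp add: carries_def)
    also have "\<dots> \<le> (\<Sum>s\<in>E `` {c}. \<alpha> s * y (c, s))"
      unfolding sum_distrib_left using m y by (intro sum_mono mult_right_mono) (auto simp: carries_def)
    finally show ?thesis .
  qed
  then show ?thesis
    unfolding exp[OF x(1)] exp[OF y] by (rule sum_mono)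
qed

lemma balanced_server_flow_unique:
  assumes G: "client_server_graph C S E"
    and a: "balanced_server_flow C S E \<alpha>" and b: "balanced_server_flow C S E \<beta>"
  shows "\<alpha> = \<beta>"
proof -
  have fl: "server_flow C S E \<alpha>" "server_flow C S E \<beta>"
    using a b by (auto simp: balanced_server_flow_def)
  have "(\<Sum>s\<in>S. (\<alpha> s - \<beta> s) * (\<alpha> s - \<beta> s)) =
      (\<Sum>s\<in>S. \<alpha> s * \<alpha> s) - (\<Sum>s\<in>S. \<alpha> s * \<beta> s) + ((\<Sum>s\<in>S. \<beta> s * \<beta> s) - (\<Sum>s\<in>S. \<beta> s * \<alpha> s))"
    by (simp add: sum_subtractf[symmetric] sum.distrib[symmetric] algebra_simps)
  also have "\<dots> \<le> 0"
    using balanced_sum_le[OF G a fl(2)] balanced_sum_le[OF G b fl(1)] by simp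
  finally have "(\<Sum>s\<in>S. (\<alpha> s - \<beta> s) * (\<alpha> s - \<beta> s)) \<le> 0" .
  moreover have "0 \<le> (\<Sum>s\<in>S. (\<alpha> s - \<beta> s) * (\<alpha> s - \<beta> s))"
    by (intro sum_nonneg) simp
  ultimately have "\<forall>s\<in>S. (\<alpha> s - \<beta> s) * (\<alpha> s - \<beta> s) = 0"
    using G sum_nonneg_eq_0_iff[of S "\<lambda>s. (\<alpha> s - \<beta> s) * (\<alpha> s - \<beta> s)"]
    by (auto simp: client_server_graph_def)
  then have "\<alpha> s = \<beta> s" if "s \<in> S" for s using that by auto
  moreover have "\<alpha> \<in> S \<rightarrow>\<^sub>E {0..}" "\<beta> \<in> S \<rightarrow>\<^sub>E {0..}"
    using fl by (auto simp: server_flow_def)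
  ultimately show ?thesis by (intro PiE_ext)
qed

lemma balanced_server_flow_exists:
  assumes G: "client_server_graph C S E"
  shows "\<exists>\<alpha>. balanced_server_flow C S E \<alpha>"
proof -
  have fin: "finite C" "finite S" "E \<subseteq> C \<times> S" and ne: "\<And>c. c \<in> C \<Longrightarrow> E `` {c} \<noteq> {}"
    using G by (auto simp: client_server_graph_def)
  have finN: "finite (E `` {c})" "finite (E\<inverse> `` {s})" for c s
    using fin by (auto intro: finite_subset)
  define B where "B = (UNIV :: ('a \<times> 'b) set) \<rightarrow>\<^sub>E {0..1::real}"
  define X where "X = B \<inter> (\<Inter>c\<in>C. {x. (\<Sum>s\<in>E `` {c}. x (c, s)) = 1})"
  define val where "val x s = (\<Sum>c\<in>E\<inverse> `` {s}. x (c, s))" for x :: "'a \<times> 'b \<Rightarrow> real" and s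
  define Q where "Q x = (\<Sum>s\<in>S. (val x s)\<^sup>2)" for x
  have "compactin (product_topology (\<lambda>_. euclidean) UNIV) B"
    unfolding B_def by (subst compactin_PiE) auto
  then have "compact B" by (simp add: euclidean_product_topology)
  moreover have "closed {x :: 'a \<times> 'b \<Rightarrow> real. (\<Sum>s\<in>E `` {c}. x (c, s)) = 1}" for c
    by (intro closed_Collect_eq continuous_intros continuous_on_product_coordinates)
  ultimately have "compact X"
    unfolding X_def by (intro compact_Int_closed closed_INT) auto
  moreover have "X \<noteq> {}"
  proof -
    have "\<forall>c\<in>C. \<exists>s. s \<in> E `` {c}" using ne by blast
    then obtain f where f: "\<And>c. c \<in> C \<Longrightarrow> f c \<in> E `` {c}" by metis
    have "(\<lambda>(c, s). if s = f c then 1 else 0) \<in> X"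
      using f finN by (auto simp: X_def B_def sum.delta)
    then show ?thesis by auto
  qed
  moreover have "continuous_on X Q"
    unfolding Q_def val_def by (intro continuous_intros continuous_on_product_coordinates
        continuous_on_subset[OF continuous_on_product_coordinates]) auto
  ultimately obtain x where x: "x \<in> X" "\<And>y. y \<in> X \<Longrightarrow> Q x \<le> Q y"
    using continuous_attains_inf by metis
  have x01: "0 \<le> x e" "x e \<le> 1" for e
    using x(1) by (cases e; auto simp: X_def B_def PiE_iff)+
  have xs: "(\<Sum>s\<in>E `` {c}. x (c, s)) = 1" if "c \<in> C" for c using x(1) that by (auto simp: X_def)
  have key: "x (c, s) = 0" if e: "(c, s) \<in> E" "(c, t) \<in> E" and lt: "val x t < val x s" for c s t
  proof (rule ccontr)
    assume "x (c, s) \<noteq> 0"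
    then have pos: "x (c, s) > 0" using x01[of "(c,s)"] by simp
    have ct: "c \<in> C" "s \<in> S" "t \<in> S" "s \<noteq> t" using e fin lt by auto
    define d where "d = min (x (c, s)) ((val x s - val x t) / 2)"
    have d: "0 < d" "d \<le> x (c, s)" "2 * d \<le> val x s - val x t" using pos lt by (auto simp: d_def min_def field_simps)
    define y where "y = x((c, s) := x (c, s) - d, (c, t) := x (c, t) + d)"
    have two: "x (c, s) + x (c, t) \<le> 1"
    proof -
      have "(\<Sum>u\<in>{s, t}. x (c, u)) \<le> (\<Sum>u\<in>E `` {c}. x (c, u))"
        using e finN x01 by (intro sum_mono2) auto
      then show ?thesis using ct xs[of c] by simp
    qed
    have sumN: "(\<Sum>u\<in>E `` {c'}. y (c', u)) = 1" if c': "c' \<in> C" for c'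
    proof (cases "c' = c")
      case True
      have "(\<Sum>u\<in>E `` {c}. y (c, u)) =
          (\<Sum>u\<in>E `` {c}. x (c, u) - (if u = s then d else 0) + (if u = t then d else 0))"
        using ct by (intro sum.cong) (auto simp: y_def)
      also have "\<dots> = 1"
        using e ct xs[of c] finN by (simp add: sum.distrib sum_subtractf sum.delta')
      finally show ?thesis using True by simp
    next
      case False
      then show ?thesis using xs[OF c'] by (simp add: y_def)
    qed
    have "y e \<in> {0..1}" for e
      using x01[of e] x01[of "(c, s)"] x01[of "(c, t)"] d two by (auto simp: y_def)
    then have "y \<in> X" using sumN by (auto simp: X_def B_def PiE_iff)
    have vs: "val y s = val x s - d"
    proof -
      have "val y s = (\<Sum>c'\<in>E\<inverse> `` {s}. x (c', s) - (if c' = c then d else 0))"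
        unfolding val_def using ct by (intro sum.cong) (auto simp: y_def)
      then show ?thesis using e finN by (simp add: val_def sum_subtractf sum.delta')
    qed
    have vt: "val y t = val x t + d"
    proof -
      have "val y t = (\<Sum>c'\<in>E\<inverse> `` {t}. x (c', t) + (if c' = c then d else 0))"
        unfolding val_def using ct by (intro sum.cong) (auto simp: y_def)
      then show ?thesis using e finN by (simp add: val_def sum.distrib sum.delta')
    qed
    have vo: "val y u = val x u" if "u \<noteq> s" "u \<noteq> t" for u
      using that by (auto simp: val_def y_def)
    have split: "Q z = (val z s)\<^sup>2 + (val z t)\<^sup>2 + (\<Sum>u\<in>S - {s} - {t}. (val z u)\<^sup>2)" for z
      unfolding Q_def using ct fin by (simp add: sum.remove[of S s] sum.remove[of "S - {s}" t])
    have "(\<Sum>u\<in>S - {s} - {t}. (val y u)\<^sup>2) = (\<Sum>u\<in>S - {s} - {t}. (val x u)\<^sup>2)"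
      using vo by (intro sum.cong) auto
    then have "Q y - Q x = 2 * d * (d - (val x s - val x t))"
      unfolding split vs vt by (simp add: power2_eq_square algebra_simps)
    also have "\<dots> < 0" using d lt by (intro mult_pos_neg) auto
    finally show False using x(2)[OF \<open>y \<in> X\<close>] by simp
  qed
  define \<alpha> where "\<alpha> = restrict (val x) S"
  have "\<alpha> \<in> S \<rightarrow>\<^sub>E {0..}" using x01 by (auto simp: \<alpha>_def val_def intro!: sum_nonneg)
  moreover have car: "carries C S E x \<alpha>" using x01 xs by (auto simp: carries_def \<alpha>_def val_def)
  moreover have "x (c, s) = 0" if cs: "(c, s) \<in> E" "s \<notin> active_servers E \<alpha> c" for c s
  proof -
    obtain t where "(c, t) \<in> E" "\<alpha> t < \<alpha> s"
      using cs by (auto simp: active_servers_def is_arg_min_def)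
    moreover have "s \<in> S" "t \<in> S" using cs calculation fin by auto
    ultimately show ?thesis using key[of c s t] cs by (auto simp: \<alpha>_def)
  qed
  ultimately have "balanced_server_flow C S E \<alpha>"
    unfolding balanced_server_flow_def server_flow_def by blast
  then show ?thesis by blast
qed

lemma balanced_value_balanced:
  assumes "client_server_graph C S E"
  shows "balanced_server_flow C S E (balanced_value C S E)"
  unfolding balanced_value_def
  using balanced_server_flow_exists[OF assms] balanced_server_flow_unique[OF assms]
  by (metis theI')

definition allowance :: "real \<Rightarrow> 'c set \<Rightarrow> 's set \<Rightarrow> ('c \<times> 's) set \<Rightarrow> 's \<Rightarrow> int" where
  "allowance \<epsilon> C S E s = \<lceil>(1 + \<epsilon>) * balanced_value C S E s\<rceil>"

text \<open>An assignment is represented by its set \<open>M\<close> of assignment edges.\<close>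

definition load :: "('c \<times> 's) set \<Rightarrow> 's \<Rightarrow> nat" where
  "load M s = card (M\<inverse> `` {s})"

definition approx_semi_matching ::
  "real \<Rightarrow> 'c set \<Rightarrow> 's set \<Rightarrow> ('c \<times> 's) set \<Rightarrow> ('c \<times> 's) set \<Rightarrow> bool" where
  "approx_semi_matching \<epsilon> C S E M \<longleftrightarrow>
     M \<subseteq> E \<and> (\<forall>c\<in>C. \<exists>!s. (c, s) \<in> M) \<and>
     (\<forall>s\<in>S. int (load M s) \<le> allowance \<epsilon> C S E s)"

text \<open>
  The path \<open>c\<^sub>0, s\<^sub>0, c\<^sub>1, s\<^sub>1, \<dots>, c\<^sub>k, s\<^sub>k\<close> is encoded by the list
  \<open>[(c\<^sub>0, s\<^sub>0), \<dots>, (c\<^sub>k, s\<^sub>k)]\<close> of its non-assignment edges; its assignment edges are then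
  \<open>(c\<^sub>1, s\<^sub>0), \<dots>, (c\<^sub>k, s\<^bsub>k-1\<^esub>)\<close>.
\<close>

definition back_edges :: "('c \<times> 's) list \<Rightarrow> ('c \<times> 's) list" where
  "back_edges p = zip (map fst (tl p)) (map snd (butlast p))"

definition path_length :: "('c \<times> 's) list \<Rightarrow> nat" where
  "path_length p = length p + length (back_edges p)"

definition augmenting_path ::
  "real \<Rightarrow> 'c set \<Rightarrow> 's set \<Rightarrow> ('c \<times> 's) set \<Rightarrow> ('c \<times> 's) set \<Rightarrow> 'c \<Rightarrow> ('c \<times> 's) list \<Rightarrow> bool" where
  "augmenting_path \<epsilon> C S E M c p \<longleftrightarrow>
     p \<noteq> [] \<and> fst (hd p) = c \<and>
     distinct (map fst p) \<and> distinct (map snd p) \<and>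
     set p \<subseteq> E - M \<and> set (back_edges p) \<subseteq> M \<and>
     int (load M (snd (last p))) < allowance \<epsilon> C S E (snd (last p))"

definition shortest_augmenting_path ::
  "real \<Rightarrow> 'c set \<Rightarrow> 's set \<Rightarrow> ('c \<times> 's) set \<Rightarrow> ('c \<times> 's) set \<Rightarrow> 'c \<Rightarrow> ('c \<times> 's) list \<Rightarrow> bool" where
  "shortest_augmenting_path \<epsilon> C S E M c p \<longleftrightarrow>
     is_arg_min path_length (augmenting_path \<epsilon> C S E M c) p"

definition augment :: "('c \<times> 's) set \<Rightarrow> ('c \<times> 's) list \<Rightarrow> ('c \<times> 's) set" where
  "augment M p = (M - set (back_edges p)) \<union> set p"

text \<open>
  Client \<open>c\<close> arrives with neighbourhood \<open>N\<close>. The allowances that decide where an augmenting path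
  may end are those of the graph that already contains \<open>c\<close>.
\<close>

definition sap_insertion ::
  "real \<Rightarrow> 's set \<Rightarrow> 'c set \<Rightarrow> ('c \<times> 's) set \<Rightarrow> ('c \<times> 's) set \<Rightarrow> 'c \<Rightarrow> 's set \<Rightarrow> ('c \<times> 's) set \<Rightarrow> bool" where
  "sap_insertion \<epsilon> S C E M c N M' \<longleftrightarrow>
     c \<notin> C \<and> N \<subseteq> S \<and> N \<noteq> {} \<and>
     (\<exists>p. shortest_augmenting_path \<epsilon> (insert c C) S (E \<union> {c} \<times> N) M c p \<and> M' = augment M p) \<and>
     approx_semi_matching \<epsilon> (insert c C) S (E \<union> {c} \<times> N) M'"

inductive sap_maintained ::
  "real \<Rightarrow> 's set \<Rightarrow> 'c set \<Rightarrow> ('c \<times> 's) set \<Rightarrow> ('c \<times> 's) set \<Rightarrow> bool"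
  for \<epsilon> :: real and S :: "'s set" where
  start: "sap_maintained \<epsilon> S {} {} {}"
| insertion: "sap_maintained \<epsilon> S C E M \<Longrightarrow> sap_insertion \<epsilon> S C E M c N M' \<Longrightarrow>
     sap_maintained \<epsilon> S (insert c C) (E \<union> {c} \<times> N) M'"

text \<open>The first assignment of the arriving client is not a reassignment; \<open>C\<close> are the old clients.\<close>

definition reassignments :: "'c set \<Rightarrow> ('c \<times> 's) set \<Rightarrow> ('c \<times> 's) set \<Rightarrow> nat" where
  "reassignments C M M' = card {c\<in>C. M `` {c} \<noteq> M' `` {c}}"

lemma sap_maintained_graph:
  assumes "sap_maintained \<epsilon> S C E M" "finite S"
  shows "client_server_graph C S E"
  using assms by induction (auto simp: client_server_graph_def sap_insertion_def)

end

theory Submission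
  imports Defs
begin

text \<open>
  Let \<open>R i\<close> be the set of servers that are reachable from the arriving client by an alternating path
  with at most \<open>i + 1\<close> non-assignment edges, and suppose that the shortest augmenting path has
  \<open>k + 1\<close> of them. For \<open>i < k\<close> every server of \<open>R i\<close> is saturated, so at least
  \<open>(1 + \<epsilon>) \<Sum>\<^bsub>R i\<^esub> \<alpha>\<close> clients are assigned to \<open>R i\<close>. All their neighbours lie in \<open>R (i + 1)\<close>, hence
  their whole unit flow does, and \<open>\<Sum>\<^bsub>R (i + 1)\<^esub> \<alpha> \<ge> (1 + \<epsilon>) \<Sum>\<^bsub>R i\<^esub> \<alpha>\<close>. As the total flow is \<open>n\<close>, this
  gives \<open>(1 + \<epsilon>)\<^sup>k \<le> n\<close>, and an augmentation along the path reassigns at most \<open>k\<close> clients.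
\<close>

section \<open>Double counting of flow by clients and by servers\<close>

lemma server_flow_total:
  assumes G: "client_server_graph C S E" and fl: "server_flow C S E \<alpha>"
  shows "(\<Sum>s\<in>S. \<alpha> s) = real (card C)"
proof -
  obtain x where x: "carries C S E x \<alpha>" using fl by (auto simp: server_flow_def)
  have "(\<Sum>s\<in>S. \<alpha> s) = (\<Sum>s\<in>S. \<Sum>c\<in>E\<inverse> `` {s}. x (c, s))"
    using x by (auto simp: carries_def)
  also have "\<dots> = (\<Sum>c\<in>C. \<Sum>s\<in>E `` {c}. x (c, s))"
    by (rule sum_edges_by_client[OF G])
  also have "\<dots> = real (card C)" using x by (simp add: carries_def)
  finally show ?thesis .
qed

text \<open>Each client of \<open>D\<close> sends its whole unit into \<open>T\<close>; the other
  clients can only add nonnegative flow there.\<close>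

lemma card_le_server_flow_sum:
  assumes G: "client_server_graph C S E" and fl: "server_flow C S E \<alpha>"
    and D: "D \<subseteq> C" and T: "T \<subseteq> S" and DT: "E `` D \<subseteq> T"
  shows "real (card D) \<le> (\<Sum>s\<in>T. \<alpha> s)"
proof -
  obtain x where x: "carries C S E x \<alpha>" using fl by (auto simp: server_flow_def)
  have fin: "finite C" "finite S" using G by (auto simp: client_server_graph_def)
  \<comment> \<open>Cutting the flow off outside \<open>T\<close> keeps the exchange of sums over
    all of \<open>S\<close> applicable.\<close>
  define f where "f c s = (if s \<in> T then x (c, s) else 0)" for c s
  have "real (card D) = (\<Sum>c\<in>D. \<Sum>s\<in>E `` {c}. x (c, s))"
    using x D by (simp add: carries_def subset_iff)
  also have "\<dots> = (\<Sum>c\<in>D. \<Sum>s\<in>E `` {c}. f c s)"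
    using DT by (intro sum.cong refl) (auto simp: f_def)
  also have "\<dots> \<le> (\<Sum>c\<in>C. \<Sum>s\<in>E `` {c}. f c s)"
    using fin D x by (intro sum_mono2 sum_nonneg) (auto simp: f_def carries_def)
  also have "\<dots> = (\<Sum>s\<in>S. \<Sum>c\<in>E\<inverse> `` {s}. f c s)"
    by (rule sum_edges_by_client[OF G, symmetric])
  also have "\<dots> = (\<Sum>s\<in>S. if s \<in> T then \<alpha> s else 0)"
    using x by (intro sum.cong refl) (auto simp: f_def carries_def)
  also have "\<dots> = (\<Sum>s\<in>T. \<alpha> s)"
    using fin T by (simp add: sum.inter_restrict[symmetric] Int_absorb1)
  finally show ?thesis .
qed

section \<open>Alternating paths and the servers they reach\<close>

lemma back_edges_snoc:
  "p \<noteq> [] \<Longrightarrow> back_edges (p @ [e]) = back_edges p @ [(fst e, snd (last p))]"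
proof -
  assume "p \<noteq> []"
  then have "map snd p = map snd (butlast p) @ [snd (last p)]"
    by (cases p rule: rev_cases) auto
  then show ?thesis using \<open>p \<noteq> []\<close> by (simp add: back_edges_def)
qed

lemma path_length_eq: "path_length p = 2 * length p - 1"
  by (cases p) (auto simp: path_length_def back_edges_def)

text \<open>With \<open>M\<close> single-valued, this places the server of any later client of the
  path on the path itself, before its last edge.\<close>

lemma back_edges_predecessor:
  assumes "c \<in> fst ` set (tl p)"
  shows "\<exists>s \<in> snd ` set (butlast p). (c, s) \<in> set (back_edges p)"
proof -
  obtain i where i: "i < length (tl p)" "c = fst (tl p ! i)"
    using assms by (auto simp: in_set_conv_nth)
  then have "back_edges p ! i = (c, snd (butlast p ! i))" "i < length (back_edges p)"
    by (auto simp: back_edges_def)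
  then have "(c, snd (butlast p ! i)) \<in> set (back_edges p)" by (metis nth_mem)
  moreover have "snd (butlast p ! i) \<in> snd ` set (butlast p)" using i by simp
  ultimately show ?thesis by blast
qed

text \<open>An augmenting path without the condition on its end, since the search also passes
  through saturated servers.\<close>

definition alternating_path ::
  "('c \<times> 's) set \<Rightarrow> ('c \<times> 's) set \<Rightarrow> 'c \<Rightarrow> ('c \<times> 's) list \<Rightarrow> bool" where
  "alternating_path E M c p \<longleftrightarrow>
     p \<noteq> [] \<and> fst (hd p) = c \<and> distinct (map fst p) \<and> distinct (map snd p) \<and>
     set p \<subseteq> E - M \<and> set (back_edges p) \<subseteq> M"

lemma augmenting_path_iff_alternating_path:
  "augmenting_path \<epsilon> C S E M c p \<longleftrightarrow>
     alternating_path E M c p \<and> int (load M (snd (last p))) < allowance \<epsilon> C S E (snd (last p))"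
  by (auto simp: augmenting_path_def alternating_path_def)

text \<open>Only the server \<open>s\<close> has to be assumed new. If \<open>d\<close> were on the
  path already, it would be either \<open>c\<close>, which is unassigned, or assigned to a server
  before the last one, against distinctness of the servers.\<close>

lemma alternating_path_snoc:
  assumes p: "alternating_path E M c p" and sv: "single_valued M" and c: "c \<notin> Domain M"
    and d: "(d, snd (last p)) \<in> M" and s: "(d, s) \<in> E" "s \<notin> snd ` set p"
  shows "alternating_path E M c (p @ [(d, s)])"
proof -
  have ne: "p \<noteq> []" and dist: "distinct (map snd p)" and be: "set (back_edges p) \<subseteq> M"
    using p by (auto simp: alternating_path_def)
  have "d \<notin> fst ` set p"
  proof
    assume "d \<in> fst ` set p"
    moreover have "d \<noteq> fst (hd p)" using p c d by (auto simp: alternating_path_def)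
    ultimately have "d \<in> fst ` set (tl p)" using ne by (cases p) auto
    then obtain t where t: "t \<in> snd ` set (butlast p)" "(d, t) \<in> M"
      using back_edges_predecessor[of d p] be by auto
    then have "snd (last p) \<in> snd ` set (butlast p)" using single_valuedD[OF sv t(2) d] by simp
    moreover have "distinct (map snd (butlast p @ [last p]))" using dist ne by simp
    ultimately show False by auto
  qed
  moreover have "(d, s) \<notin> M"
    using single_valuedD[OF sv d] s(2) ne by (metis imageI last_in_set)
  ultimately show ?thesis
    using p d s ne by (auto simp: alternating_path_def back_edges_snoc)
qed

text \<open>Cumulative breadth-first layers. They follow all edges and ignore simplicity of paths,
  so that a layer contains every neighbour of the clients assigned to the previous one, as the flow
  count requires.\<close>

primrec reachable_servers ::
  "('c \<times> 's) set \<Rightarrow> ('c \<times> 's) set \<Rightarrow> 'c \<Rightarrow> nat \<Rightarrow> 's set" where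
  "reachable_servers E M c 0 = E `` {c}"
| "reachable_servers E M c (Suc i) =
     reachable_servers E M c i \<union> E `` (M\<inverse> `` reachable_servers E M c i)"

lemma reachable_servers_subset: "E \<subseteq> C \<times> S \<Longrightarrow> reachable_servers E M c i \<subseteq> S"
  by (induction i) auto

text \<open>The last conjunct strengthens the induction: a server outside layer \<open>i\<close> is
  not on a path inside layer \<open>i\<close>, so that path can be extended to it.\<close>

lemma reachable_servers_alternating_path:
  assumes sv: "single_valued M" and c: "c \<notin> Domain M"
  shows "s \<in> reachable_servers E M c i \<Longrightarrow>
    \<exists>p. alternating_path E M c p \<and> snd (last p) = s \<and> length p \<le> Suc i \<and>
        snd ` set p \<subseteq> reachable_servers E M c i"
proof (induction i arbitrary: s)
  case 0
  then have "alternating_path E M c [(c, s)]"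
    using c by (auto simp: alternating_path_def back_edges_def)
  then show ?case using 0 by (intro exI[of _ "[(c, s)]"]) auto
next
  case (Suc i)
  show ?case
  proof (cases "s \<in> reachable_servers E M c i")
    case True
    then show ?thesis using Suc.IH[OF True] by fastforce
  next
    case False
    then obtain d t where t: "t \<in> reachable_servers E M c i" "(d, t) \<in> M" "(d, s) \<in> E"
      using Suc.prems by auto
    obtain p where p: "alternating_path E M c p" "snd (last p) = t" "length p \<le> Suc i"
        "snd ` set p \<subseteq> reachable_servers E M c i"
      using Suc.IH[OF t(1)] by blast
    have "alternating_path E M c (p @ [(d, s)])"
      using alternating_path_snoc[OF p(1) sv c] p t False by blast
    then show ?thesis using p Suc.prems by (intro exI[of _ "p @ [(d, s)]"]) auto
  qed
qed

section \<open>Growth of the flow from layer to layer\<close>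

lemma card_assigned_eq_sum_load:
  assumes "single_valued M" "finite M" "finite T"
  shows "card (M\<inverse> `` T) = (\<Sum>s\<in>T. load M s)"
proof -
  have "finite (M\<inverse> `` {s})" for s
    using assms(2) by (intro finite_Image) auto
  then have "card (\<Union>s\<in>T. M\<inverse> `` {s}) = (\<Sum>s\<in>T. load M s)"
    unfolding load_def using assms by (intro card_UN_disjoint) (auto dest: single_valuedD)
  moreover have "M\<inverse> `` T = (\<Union>s\<in>T. M\<inverse> `` {s})" by auto
  ultimately show ?thesis by simp
qed

lemma reachable_servers_flow_growth:
  assumes G: "client_server_graph C S E" and M: "M \<subseteq> E" "single_valued M"
    and c: "c \<in> C" and eps: "0 \<le> \<epsilon>"
    and sat: "\<And>j s. j < i \<Longrightarrow> s \<in> reachable_servers E M c j \<Longrightarrow>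
      allowance \<epsilon> C S E s \<le> int (load M s)"
  shows "(1 + \<epsilon>) ^ i \<le> (\<Sum>s\<in>reachable_servers E M c i. balanced_value C S E s)"
  using sat
proof (induction i)
  case 0
  have fl: "server_flow C S E (balanced_value C S E)"
    using balanced_value_balanced[OF G] by (simp add: balanced_server_flow_def)
  \<comment> \<open>The unit of the arriving client alone goes into its neighbourhood.\<close>
  show ?case
    using card_le_server_flow_sum[OF G fl, of "{c}" "E `` {c}"] c G
    by (auto simp: client_server_graph_def)
next
  case (Suc i)
  let ?\<alpha> = "balanced_value C S E" and ?R = "reachable_servers E M c"
  have fl: "server_flow C S E ?\<alpha>"
    using balanced_value_balanced[OF G] by (simp add: balanced_server_flow_def)
  have E: "E \<subseteq> C \<times> S" "finite C" "finite S" using G by (auto simp: client_server_graph_def)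
  have RS: "?R j \<subseteq> S" for j using reachable_servers_subset[OF E(1)] .
  have "finite E" using E by (meson finite_SigmaI finite_subset)
  then have fin: "finite M" "finite (?R i)"
    using M(1) finite_subset[OF RS E(3)] by (auto intro: finite_subset)
  have "(1 + \<epsilon>) ^ i \<le> (\<Sum>s\<in>?R i. ?\<alpha> s)"
    by (rule Suc.IH, rule Suc.prems) simp_all
  then have "(1 + \<epsilon>) ^ Suc i \<le> (1 + \<epsilon>) * (\<Sum>s\<in>?R i. ?\<alpha> s)"
    using eps by (simp add: mult_left_mono)
  also have "\<dots> = (\<Sum>s\<in>?R i. (1 + \<epsilon>) * ?\<alpha> s)" by (rule sum_distrib_left)
  \<comment> \<open>Saturation gives load at least the allowance, and the rounding in the allowance
    is upwards.\<close>
  also have "\<dots> \<le> (\<Sum>s\<in>?R i. real (load M s))"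
  proof (rule sum_mono)
    fix s assume "s \<in> ?R i"
    then have "\<lceil>(1 + \<epsilon>) * ?\<alpha> s\<rceil> \<le> int (load M s)"
      using Suc.prems[of i s] by (simp add: allowance_def)
    then show "(1 + \<epsilon>) * ?\<alpha> s \<le> real (load M s)" by (simp add: ceiling_le_iff)
  qed
  also have "\<dots> = real (card (M\<inverse> `` ?R i))"
    using card_assigned_eq_sum_load[OF M(2) fin] by simp
  also have "\<dots> \<le> (\<Sum>s\<in>?R (Suc i). ?\<alpha> s)"
    using M E by (intro card_le_server_flow_sum[OF G fl _ RS]) auto
  finally show ?case .
qed

lemma shortest_augmenting_path_length_bound:
  assumes G: "client_server_graph C S E" and M: "M \<subseteq> E" "single_valued M"
    and c: "c \<in> C" "c \<notin> Domain M" and eps: "0 \<le> \<epsilon>"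
    and p: "shortest_augmenting_path \<epsilon> C S E M c p"
  shows "(1 + \<epsilon>) ^ (length p - 1) \<le> real (card C)"
proof -
  let ?\<alpha> = "balanced_value C S E" and ?R = "reachable_servers E M c"
  have fl: "server_flow C S E ?\<alpha>"
    using balanced_value_balanced[OF G] by (simp add: balanced_server_flow_def)
  have E: "E \<subseteq> C \<times> S" "finite S" using G by (auto simp: client_server_graph_def)
  \<comment> \<open>Layer \<open>j\<close> is reached with at most \<open>j + 1 < length p\<close>
    non-assignment edges, so spare allowance there would give an augmenting path shorter than
    \<open>p\<close>.\<close>
  have sat: "allowance \<epsilon> C S E s \<le> int (load M s)"
    if j: "j < length p - 1" and s: "s \<in> ?R j" for j s
  proof (rule ccontr)
    assume "\<not> ?thesis"
    moreover obtain q where q: "alternating_path E M c q" "snd (last q) = s" "length q \<le> Suc j"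
      using reachable_servers_alternating_path[OF M(2) c(2) s] by blast
    ultimately have "augmenting_path \<epsilon> C S E M c q"
      by (simp add: augmenting_path_iff_alternating_path)
    then have "path_length p \<le> path_length q"
      using p by (auto simp: shortest_augmenting_path_def is_arg_min_def not_less)
    then show False using q(3) j by (simp add: path_length_eq)
  qed
  have "(1 + \<epsilon>) ^ (length p - 1) \<le> (\<Sum>s\<in>?R (length p - 1). ?\<alpha> s)"
    by (rule reachable_servers_flow_growth[OF G M c(1) eps]) (rule sat)
  also have "\<dots> \<le> (\<Sum>s\<in>S. ?\<alpha> s)"
    using fl by (intro sum_mono2 E(2) reachable_servers_subset[OF E(1)])
      (auto simp: server_flow_def PiE_iff)
  also have "\<dots> = real (card C)" by (rule server_flow_total[OF G fl])
  finally show ?thesis .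
qed

section \<open>Reassignments and the logarithmic bound\<close>

lemma reassignments_augment_le:
  assumes "fst (hd p) \<notin> C"
  shows "reassignments C M (augment M p) \<le> length p - 1"
proof -
  \<comment> \<open>Only clients on the path change edges, and its first client is not an old one,
    hence \<open>tl\<close>.\<close>
  have "{c \<in> C. M `` {c} \<noteq> augment M p `` {c}} \<subseteq> fst ` set (tl p)"
  proof
    fix c assume "c \<in> {c \<in> C. M `` {c} \<noteq> augment M p `` {c}}"
    then have c: "c \<in> C" and ne: "M `` {c} \<noteq> augment M p `` {c}" by auto
    show "c \<in> fst ` set (tl p)"
    proof (rule ccontr)
      assume no: "c \<notin> fst ` set (tl p)"
      then have "(c, s) \<notin> set (back_edges p)" for s
        by (auto simp: back_edges_def dest!: set_zip_leftD)
      moreover have "(c, s) \<notin> set p" for s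
        using no c assms by (cases p) force+
      ultimately show False using ne by (auto simp: augment_def)
    qed
  qed
  then have "reassignments C M (augment M p) \<le> card (fst ` set (tl p))"
    unfolding reassignments_def by (intro card_mono) auto
  also have "\<dots> \<le> card (set (tl p))" by (rule card_image_le) simp
  also have "\<dots> \<le> length p - 1" using card_length[of "tl p"] by simp
  finally show ?thesis .
qed

text \<open>Every insertion certifies its result as a semi-matching, so inspecting the last step
  suffices.\<close>

lemma sap_maintained_assignment:
  assumes "sap_maintained \<epsilon> S C E M" "finite S"
  shows "M \<subseteq> E" "single_valued M" "Domain M \<subseteq> C"
proof -
  have G: "client_server_graph C S E" using sap_maintained_graph[OF assms] .
  have *: "M \<subseteq> E \<and> (\<forall>c\<in>C. \<exists>!s. (c, s) \<in> M)"
    using assms(1) by cases (auto simp: sap_insertion_def approx_semi_matching_def)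
  then show "M \<subseteq> E" and D: "Domain M \<subseteq> C" using G by (auto simp: client_server_graph_def)
  show "single_valued M" using * D by (intro single_valuedI) (metis Domain.DomainI subsetD)
qed

text \<open>By concavity, the graph of \<open>ln (1 + x)\<close> lies above its chord over the
  interval from 0 to \<open>b\<close>.\<close>

lemma ln_one_plus_ge_linear:
  fixes x b :: real
  assumes "0 < x" "x \<le> b"
  shows "x * ln (1 + b) / b \<le> ln (1 + x)"
proof -
  have "concave_on {0<..} (ln :: real \<Rightarrow> real)"
    by (rule ln_concave)
  then have "(1 - x / b) * ln 1 + (x / b) * ln (1 + b) \<le> ln ((1 - x / b) *\<^sub>R 1 + (x / b) *\<^sub>R (1 + b))"
    using assms by (intro concave_onD) (auto simp: field_simps)
  moreover have "(1 - x / b) *\<^sub>R 1 + (x / b) *\<^sub>R (1 + b) = 1 + x"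
    using assms by (simp add: field_simps)
  ultimately show ?thesis by (metis add_0 ln_one mult_zero_right times_divide_eq_left)
qed

theorem theorem37:
  fixes \<epsilon>\<^sub>0 :: real
  assumes "\<epsilon>\<^sub>0 > 0"
  shows "\<exists>K>0. \<forall>\<epsilon> (S :: 's set) (C :: 'c set) E M c N M'.
           0 < \<epsilon> \<and> \<epsilon> \<le> \<epsilon>\<^sub>0 \<and> finite S \<and>
           sap_maintained \<epsilon> S C E M \<and> sap_insertion \<epsilon> S C E M c N M' \<longrightarrow>
           real (reassignments C M M') \<le> K * ((1 / \<epsilon>) * ln (real (card (insert c C))))"
proof (intro exI[of _ "\<epsilon>\<^sub>0 / ln (1 + \<epsilon>\<^sub>0)"] conjI allI impI)
  \<comment> \<open>The constant is the inverse slope of the chord of \<open>ln (1 + x)\<close> up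
    to \<open>\<epsilon>\<^sub>0\<close>; it turns \<open>1 / ln (1 + \<epsilon>)\<close> into a
    multiple of \<open>1 / \<epsilon>\<close>, uniformly on this bounded range.\<close>
  show "0 < \<epsilon>\<^sub>0 / ln (1 + \<epsilon>\<^sub>0)" using assms by simp
  fix \<epsilon> and S :: "'s set" and C :: "'c set" and E M c N M'
  assume "0 < \<epsilon> \<and> \<epsilon> \<le> \<epsilon>\<^sub>0 \<and> finite S \<and>
    sap_maintained \<epsilon> S C E M \<and> sap_insertion \<epsilon> S C E M c N M'"
  then have eps: "0 < \<epsilon>" "\<epsilon> \<le> \<epsilon>\<^sub>0" and S: "finite S"
    and sap: "sap_maintained \<epsilon> S C E M" and ins: "sap_insertion \<epsilon> S C E M c N M'" by auto
  let ?C = "insert c C" and ?E = "E \<union> {c} \<times> N"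
  have c: "c \<notin> C" using ins by (simp add: sap_insertion_def)
  obtain p where p: "shortest_augmenting_path \<epsilon> ?C S ?E M c p" "M' = augment M p"
    using ins by (auto simp: sap_insertion_def)
  have G: "client_server_graph ?C S ?E"
    using sap_maintained_graph[OF sap_maintained.insertion[OF sap ins] S] .
  note M = sap_maintained_assignment[OF sap S]
  define k where "k = length p - 1"
  \<comment> \<open>The old assignment \<open>M\<close> is viewed in the graph that already contains
    \<open>c\<close>, where \<open>c\<close> is still unassigned.\<close>
  have "(1 + \<epsilon>) ^ k \<le> real (card ?C)"
    unfolding k_def using M c eps
    by (intro shortest_augmenting_path_length_bound[OF G _ _ _ _ _ p(1)]) auto
  then have "ln ((1 + \<epsilon>) ^ k) \<le> ln (real (card ?C))"
    using eps by (intro ln_mono) auto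
  then have k: "real k * ln (1 + \<epsilon>) \<le> ln (real (card ?C))"
    using eps by (simp add: ln_realpow)
  have "fst (hd p) = c"
    using p(1) by (auto simp: shortest_augmenting_path_def is_arg_min_def augmenting_path_def)
  then have "reassignments C M M' \<le> k"
    using reassignments_augment_le[of p C M] c p(2) by (simp add: k_def)
  then have "real (reassignments C M M') \<le> real k" by simp
  \<comment> \<open>Writing \<open>k\<close> this way exposes the chord value at
    \<open>\<epsilon>\<close>, which is at most \<open>ln (1 + \<epsilon>)\<close>.\<close>
  also have "\<dots> = \<epsilon>\<^sub>0 / ln (1 + \<epsilon>\<^sub>0) * ((1 / \<epsilon>) * (real k * (\<epsilon> * ln (1 + \<epsilon>\<^sub>0) / \<epsilon>\<^sub>0)))"
    using eps assms by simp
  also have "\<dots> \<le> \<epsilon>\<^sub>0 / ln (1 + \<epsilon>\<^sub>0) * ((1 / \<epsilon>) * ln (real (card ?C)))"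
    using k mult_left_mono[OF ln_one_plus_ge_linear[OF eps], of "real k"] eps assms
    by (intro mult_left_mono) auto
  finally show "real (reassignments C M M') \<le>
      \<epsilon>\<^sub>0 / ln (1 + \<epsilon>\<^sub>0) * ((1 / \<epsilon>) * ln (real (card ?C)))" .
qed

end
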